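(* Let $\omega>0$ and let $\alpha_1,\alpha_2,\beta_1,\beta_2,\gamma_0,\gamma_1,\gamma_2,\mu_1,\mu_2$ be real numbers. For $\epsilon>0$ consider the differential system $$ \dot{x}=x(\mu-\alpha)-\beta y+xz,\qquad \dot{y}=\beta x+y(\mu-\alpha)+yz,\qquad \dot{z}=\mu z-\gamma\,(x^2+y^2+z^2), $$ with parameters $$ \alpha=\alpha_1\epsilon+\alpha_2\epsilon^2+\mathcal{O}(\epsilon^3),\quad \beta=\omega+\beta_1\epsilon+\beta_2\epsilon^2+\mathcal{O}(\epsilon^3),\quad \gamma=\gamma_0+\gamma_1\epsilon+\gamma_2\epsilon^2+\mathcal{O}(\epsilon^3),\quad \mu=\mu_1\epsilon+\mu_2\epsilon^2+\mathcal{O}(\epsilon^3). $$ Assume that $$ \alpha_1\neq 0,\qquad \gamma_0>0,\qquad (\mu_1-\alpha_1)\bigl(\alpha_1\gamma_0-(\gamma_0+1)\mu_1\bigr)>0, $$ $$ 4\alpha_1^2\gamma_0(\gamma_0+2)-4\alpha_1(\gamma_0+2)(2\gamma_0+1)\mu_1+(2\gamma_0+3)^2\mu_1^2<0. $$ Then, for $\epsilon>0$ sufficiently small, the system admits a periodic solution $\phi(t,\epsilon)$ satisfying $\phi(t,\epsilon)\to 0$ as $\epsilon\to 0$. Moreover, this periodic solution is asymptotically stable if $2\gamma_0(\mu_1-\alpha_1)+\mu_1<0$, and unstable if $2\gamma_0(\mu_1-\alpha_1)+\mu_1>0$.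
   Context: The dot denotes the derivative with respect to time $t$, and all parameters are real. The parameters $\alpha,\beta,\gamma,\mu$ are smooth functions of the perturbation parameter $\epsilon$ with the stated expansions at $\epsilon=0$. At $\epsilon=0$ the origin is a zero-Hopf equilibrium, i.e. the linearization there has eigenvalues $0,\pm i\omega$. "Periodic solution" means a nonconstant periodic solution; its stability is understood in the usual (orbital) sense for an autonomous system. *)

theory Defs
  imports "HOL-Analysis.Analysis" "HOL-Library.Landau_Symbols"
begin

text \<open>C-infinity on a neighbourhood of 0 that does not depend on the order of differentiation.\<close>

definition smooth_near_0 :: "(real \<Rightarrow> real) \<Rightarrow> bool" where
  "smooth_near_0 f \<longleftrightarrow> (\<exists>\<delta>>0. \<forall>n. (deriv ^^ n) f differentiable_on {-\<delta><..<\<delta>})"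

type_synonym real3 = "real \<times> real \<times> real"

definition zero_hopf_field :: "real \<Rightarrow> real \<Rightarrow> real \<Rightarrow> real \<Rightarrow> real3 \<Rightarrow> real3" where
  "zero_hopf_field \<alpha> \<beta> \<gamma> \<mu> = (\<lambda>(x, y, z).
     (x * (\<mu> - \<alpha>) - \<beta> * y + x * z,
      \<beta> * x + y * (\<mu> - \<alpha>) + y * z,
      \<mu> * z - \<gamma> * (x\<^sup>2 + y\<^sup>2 + z\<^sup>2)))"

definition is_solution_on ::
  "('a::real_normed_vector \<Rightarrow> 'a) \<Rightarrow> (real \<Rightarrow> 'a) \<Rightarrow> real set \<Rightarrow> bool" where
  "is_solution_on F u I \<longleftrightarrow> (\<forall>t\<in>I. (u has_vector_derivative F (u t)) (at t within I))"

definition periodic_solution ::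
  "('a::real_normed_vector \<Rightarrow> 'a) \<Rightarrow> (real \<Rightarrow> 'a) \<Rightarrow> bool" where
  "periodic_solution F u \<longleftrightarrow>
     is_solution_on F u UNIV \<and> (\<exists>T>0. \<forall>t. u (t + T) = u t) \<and> \<not> u constant_on UNIV"

text \<open>Orbital (set) stability: \<open>\<Gamma>\<close> is meant to be the orbit \<open>range u\<close> of a periodic solution
  \<open>u\<close>. Stability includes that solutions starting close to \<open>\<Gamma>\<close> exist for all forward time, so a
  blow-up in finite time arbitrarily close to \<open>\<Gamma>\<close> counts as instability.\<close>

definition orbitally_stable ::
  "('a::real_normed_vector \<Rightarrow> 'a) \<Rightarrow> 'a set \<Rightarrow> bool" where
  "orbitally_stable F \<Gamma> \<longleftrightarrow>
     (\<forall>\<eta>>0. \<exists>\<delta>>0. \<forall>p. infdist p \<Gamma> < \<delta> \<longrightarrow>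
        (\<exists>v. is_solution_on F v {0..} \<and> v 0 = p) \<and>
        (\<forall>v. is_solution_on F v {0..} \<and> v 0 = p \<longrightarrow> (\<forall>t\<ge>0. infdist (v t) \<Gamma> < \<eta>)))"

definition orbitally_asymptotically_stable ::
  "('a::real_normed_vector \<Rightarrow> 'a) \<Rightarrow> 'a set \<Rightarrow> bool" where
  "orbitally_asymptotically_stable F \<Gamma> \<longleftrightarrow>
     orbitally_stable F \<Gamma> \<and>
     (\<exists>\<delta>>0. \<forall>v. is_solution_on F v {0..} \<and> infdist (v 0) \<Gamma> < \<delta> \<longrightarrow>
        ((\<lambda>t. infdist (v t) \<Gamma>) \<longlongrightarrow> 0) at_top)"

definition orbitally_unstable ::
  "('a::real_normed_vector \<Rightarrow> 'a) \<Rightarrow> 'a set \<Rightarrow> bool" where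
  "orbitally_unstable F \<Gamma> \<longleftrightarrow> \<not> orbitally_stable F \<Gamma>"

end

theory Submission
  imports Defs "HOL-Real_Asymp.Real_Asymp"
begin

text \<open>The periodic solution is explicit. In cylindrical coordinates the system is
\<open>r' = r * (\<mu> - \<alpha> + z)\<close>, \<open>\<theta>' = \<beta>\<close>, \<open>z' = \<mu> * z - \<gamma> * (r\<^sup>2 + z\<^sup>2)\<close>, and the angle decouples. The
planar \<open>(r, z)\<close>-system has the equilibrium \<open>z = \<alpha> - \<mu>\<close>, \<open>r\<^sup>2 = s = z * (\<mu> - \<gamma> * z) / \<gamma>\<close>, which is a
round periodic orbit in space as soon as \<open>s > 0\<close>. To leading order
\<open>s = \<epsilon>\<^sup>2 * (\<mu>\<^sub>1 - \<alpha>\<^sub>1) * (\<alpha>\<^sub>1 * \<gamma>\<^sub>0 - (\<gamma>\<^sub>0 + 1) * \<mu>\<^sub>1) / \<gamma>\<^sub>0\<close>, so the orbit exists for small \<open>\<epsilon> > 0\<close> and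
shrinks to the origin.

The linearisation of the planar system at this equilibrium has positive determinant, and its trace
\<open>\<mu> - 2 * \<gamma> * (\<alpha> - \<mu>)\<close> is \<open>\<epsilon> * (2 * \<gamma>\<^sub>0 * (\<mu>\<^sub>1 - \<alpha>\<^sub>1) + \<mu>\<^sub>1)\<close> to leading order. Its sign decides
stability. This is made quantitative by one quadratic function of \<open>\<sigma> = x\<^sup>2 + y\<^sup>2 - s\<close> and
\<open>w = z - (\<alpha> - \<mu>)\<close>, which is positive off the orbit and decreases or increases exponentially along
solutions near the orbit, according to the sign of the trace (\<open>twisted_energy_estimates\<close>,
\<open>lyapunov_candidate_near_orbit\<close>).

Two general criteria turn this into statements on the orbit
(\<open>exponential_decrease_imp_orbitally_asymptotically_stable\<close>,
\<open>exponential_increase_imp_orbitally_unstable\<close>). Stability includes global forward existence, which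
rests on the Picard theorem for globally Lipschitz fields
(\<open>lipschitz_field_has_forward_solution\<close>).\<close>

section \<open>Global forward solutions of Lipschitz fields\<close>

text \<open>In the norm weighted by \<open>exp (- K * t)\<close>, integration from \<open>0\<close> costs only a factor \<open>1 / K\<close>,
uniformly in \<open>t\<close>. So a large \<open>K\<close> makes the Picard operator a contraction on the whole half-line at
once, and no local solutions have to be glued.\<close>

lemma exp_weighted_integral_bound:
  fixes h :: "real \<Rightarrow> 'a::banach"
  assumes "t \<ge> 0" "K > 0" "continuous_on {0..t} h"
    and h: "\<And>s. s \<in> {0..t} \<Longrightarrow> norm (h s) \<le> M * exp (K * s)"
  shows "exp (- K * t) * norm (integral {0..t} h) \<le> M / K"
proof -
  have "0 \<le> norm (h 0)" by simp
  also have "\<dots> \<le> M" using h[of 0] assms(1) by simp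
  finally have "M \<ge> 0" .
  have int: "((\<lambda>s. M * exp (K * s)) has_integral M * exp (K * t) / K - M * exp (K * 0) / K) {0..t}"
    using \<open>t \<ge> 0\<close> \<open>K > 0\<close>
    by (intro fundamental_theorem_of_calculus)
      (auto simp: has_real_derivative_iff_has_vector_derivative[symmetric] intro!: derivative_eq_intros)
  have "norm (integral {0..t} h) \<le> integral {0..t} (\<lambda>s. M * exp (K * s))"
    using assms int by (intro integral_norm_bound_integral integrable_continuous_real)
      (auto intro!: continuous_intros)
  also have "\<dots> = M * exp (K * t) / K - M / K"
    using integral_unique[OF int] by simp
  also have "\<dots> \<le> M * exp (K * t) / K" using \<open>M \<ge> 0\<close> \<open>K > 0\<close> by simp
  finally have "exp (- K * t) * norm (integral {0..t} h) \<le> exp (- K * t) * (M * exp (K * t) / K)"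
    by (rule mult_left_mono) simp
  also have "\<dots> = M / K" by (simp add: exp_minus)
  finally show ?thesis .
qed

text \<open>Write a solution as \<open>v t = p + exp (K * t) *\<^sub>R w t\<close>; the integral equation for \<open>v\<close> turns into a
fixed-point equation for the bounded continuous function \<open>w\<close>, and \<open>K > L\<close> makes it contractive.\<close>

lemma lipschitz_field_has_forward_solution:
  fixes G :: "'a::banach \<Rightarrow> 'a"
  assumes G: "L-lipschitz_on UNIV G"
  shows "\<exists>v. is_solution_on G v {0..} \<and> v 0 = p"
proof -
  define K where "K = 2 * L + 1"
  have L: "L \<ge> 0" using G lipschitz_on_nonneg by blast
  then have K: "K > 0" by (simp add: K_def)
  have contG: "continuous_on UNIV G" using G by (rule lipschitz_on_continuous_on)
  define rhs where "rhs w s = G (p + exp (K * s) *\<^sub>R apply_bcontfun w s)"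
    for w :: "real \<Rightarrow>\<^sub>C 'a" and s
  \<comment> \<open>clamping \<open>t\<close> to the half-line makes \<open>P w\<close> a function on all of \<open>\<real>\<close>, as the type of \<open>w\<close> requires\<close>
  define P where "P w t = exp (- K * max 0 t) *\<^sub>R integral {0..max 0 t} (rhs w)" for w t
  have cont_rhs: "continuous_on S (rhs w)" for S w
    unfolding rhs_def
    by (rule continuous_on_compose2[OF contG]) (auto intro!: continuous_intros)
  have deriv: "((\<lambda>u. integral {0..u} (rhs w)) has_vector_derivative rhs w t) (at t within {0..})"
    if "t \<ge> 0" for w t
  proof -
    have "at t within {0..} = at t within {0..t+1}"
      by (rule at_within_nhd[where S = "{..<t+1}"]) auto
    then show ?thesis
      using integral_has_vector_derivative[OF cont_rhs[of "{0..t+1}" w], of t] that by simp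
  qed
  then have "continuous_on {0..} (\<lambda>u. integral {0..u} (rhs w))" for w
    by (force simp: continuous_on_eq_continuous_within intro: has_vector_derivative_continuous)
  then have cont_int: "continuous_on UNIV (\<lambda>t. integral {0..max 0 t} (rhs w))" for w
    by (rule continuous_on_compose2) (auto intro!: continuous_intros)
  have "P w \<in> bcontfun" for w
  proof (rule bcontfun_normI)
    show "continuous_on UNIV (P w)"
      unfolding P_def by (intro continuous_intros cont_int)
    fix t
    have "norm (rhs w s) \<le> (norm (G p) + L * norm w) * exp (K * s)" if "s \<in> {0..max 0 t}" for s
    proof -
      have "norm (rhs w s) \<le> norm (G p) + norm (rhs w s - G p)"
        by (metis add.commute diff_add_cancel norm_triangle_ineq)
      also have "norm (rhs w s - G p) \<le> L * norm (exp (K * s) *\<^sub>R w s)"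
        using lipschitz_on_normD[OF G, of "p + exp (K * s) *\<^sub>R w s" p] by (simp add: rhs_def)
      also have "\<dots> \<le> L * norm w * exp (K * s)"
        using mult_left_mono[OF norm_bounded[of w s], of "L * exp (K * s)"] L by (simp add: ac_simps)
      also have "norm (G p) \<le> norm (G p) * exp (K * s)"
        using that K by (simp add: mult_le_cancel_left1)
      finally show ?thesis by (simp add: algebra_simps)
    qed
    from exp_weighted_integral_bound[OF _ K cont_rhs this]
    show "norm (P w t) \<le> (norm (G p) + L * norm w) / K"
      by (simp add: P_def)
  qed
  then have P: "apply_bcontfun (Bcontfun (P w)) = P w" for w
    by (simp add: Bcontfun_inverse)
  have contraction: "dist (Bcontfun (P w)) (Bcontfun (P w')) \<le> L / K * dist w w'" for w w'
  proof (rule dist_bound)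
    fix t
    have "norm (rhs w s - rhs w' s) \<le> (L * dist w w') * exp (K * s)" for s
    proof -
      have "norm (rhs w s - rhs w' s) \<le> L * norm (exp (K * s) *\<^sub>R w s - exp (K * s) *\<^sub>R w' s)"
        using lipschitz_on_normD[OF G, of "p + exp (K * s) *\<^sub>R w s" "p + exp (K * s) *\<^sub>R w' s"]
        by (simp add: rhs_def)
      also have "\<dots> = L * exp (K * s) * dist (w s) (w' s)"
        by (simp add: scaleR_diff_right[symmetric] dist_norm)
      also have "\<dots> \<le> L * exp (K * s) * dist w w'"
        using L by (intro mult_left_mono dist_bounded) auto
      finally show ?thesis by (simp add: ac_simps)
    qed
    then have "exp (- K * max 0 t) * norm (integral {0..max 0 t} (\<lambda>s. rhs w s - rhs w' s))
        \<le> L * dist w w' / K"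
      by (intro exp_weighted_integral_bound K continuous_intros cont_rhs) auto
    moreover have "integral {0..max 0 t} (\<lambda>s. rhs w s - rhs w' s)
        = integral {0..max 0 t} (rhs w) - integral {0..max 0 t} (rhs w')"
      by (intro integral_diff integrable_continuous_real cont_rhs)
    ultimately show "dist (Bcontfun (P w) t) (Bcontfun (P w') t) \<le> L / K * dist w w'"
      by (simp add: P P_def dist_norm scaleR_diff_right[symmetric])
  qed
  have "L / K < 1" "0 \<le> L / K" using L K by (auto simp: K_def)
  then obtain w where w: "Bcontfun (P w) = w"
    using banach_fix_type[of "L / K" "\<lambda>w. Bcontfun (P w)"] contraction by blast
  define v where "v t = p + integral {0..t} (rhs w)" for t
  have v: "v t = p + exp (K * t) *\<^sub>R w t" if "t \<ge> 0" for t
  proof -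
    have "w t = P w t" using P[of w] w by simp
    then show ?thesis using that by (simp add: v_def P_def exp_minus)
  qed
  have "(v has_vector_derivative G (v t)) (at t within {0..})" if "t \<ge> 0" for t
    using has_vector_derivative_add[OF has_vector_derivative_const[of p] deriv[OF that, of w]] v[OF that]
    by (simp add: v_def[abs_def] rhs_def)
  moreover have "v 0 = p" by (simp add: v_def)
  ultimately show ?thesis unfolding is_solution_on_def by auto
qed

section \<open>Lyapunov functions near a compact set\<close>

lemma gronwall_differential:
  fixes f :: "real \<Rightarrow> real"
  assumes "a \<le> b" "continuous_on {a..b} f"
    and f: "\<And>t. a < t \<Longrightarrow> t < b \<Longrightarrow> (f has_real_derivative f' t) (at t)"
    and le: "\<And>t. a < t \<Longrightarrow> t < b \<Longrightarrow> f' t \<le> k * f t"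
  shows "f b \<le> f a * exp (k * (b - a))"
proof -
  define g where "g t = f t * exp (- k * (t - a))" for t
  have "g b \<le> g a"
  proof (rule DERIV_nonpos_imp_decreasing_open[OF \<open>a \<le> b\<close>])
    show "continuous_on {a..b} g"
      unfolding g_def using assms(2) by (intro continuous_intros)
    fix t assume t: "a < t" "t < b"
    have "(g has_real_derivative (f' t - k * f t) * exp (- k * (t - a))) (at t)"
      unfolding g_def using f[OF t]
      by (auto intro!: derivative_eq_intros simp: algebra_simps)
    moreover have "(f' t - k * f t) * exp (- k * (t - a)) \<le> 0"
      using le[OF t] by (intro mult_nonpos_nonneg) auto
    ultimately show "\<exists>y. (g has_real_derivative y) (at t) \<and> y \<le> 0" by blast
  qed
  then have "g b * exp (k * (b - a)) \<le> g a * exp (k * (b - a))"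
    by (intro mult_right_mono) auto
  then show ?thesis by (simp add: g_def exp_add[symmetric] mult.assoc)
qed

lemma is_solution_on_imp_continuous_on:
  "is_solution_on F v I \<Longrightarrow> continuous_on I v"
  by (auto simp: is_solution_on_def continuous_on_eq_continuous_within
      intro: has_vector_derivative_continuous)

text \<open>Gronwall's inequality for \<open>W\<close> along a solution. The rate \<open>k\<close> may have either sign: a negative one
gives decay in the stable case, and in the unstable case the lemma is applied to \<open>- W\<close>.\<close>

lemma growth_along_solution:
  fixes v :: "real \<Rightarrow> 'a::real_normed_vector"
  assumes v: "is_solution_on F v {0..}" and "t \<ge> 0"
    and N: "\<And>s. 0 \<le> s \<Longrightarrow> s \<le> t \<Longrightarrow> v s \<in> N"
    and W: "\<And>p. p \<in> N \<Longrightarrow> (W has_derivative W' p) (at p)"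
    and le: "\<And>p. p \<in> N \<Longrightarrow> W' p (F p) \<le> k * W p"
  shows "W (v t) \<le> W (v 0) * exp (k * t)"
proof -
  have "W (v t) \<le> W (v 0) * exp (k * (t - 0))"
  proof (rule gronwall_differential[OF \<open>t \<ge> 0\<close>, where f' = "\<lambda>s. W' (v s) (F (v s))"])
    show "continuous_on {0..t} (\<lambda>s. W (v s))"
    proof (rule continuous_on_compose2[where t = N])
      show "continuous_on N W"
        using W has_derivative_continuous continuous_at_imp_continuous_on by blast
      show "continuous_on {0..t} v"
        using is_solution_on_imp_continuous_on[OF v] by (rule continuous_on_subset) auto
    qed (use N in auto)
    fix s assume s: "0 < s" "s < t"
    have "at s within {0..} = at s"
      using s by (intro at_within_interior) (simp add: interior_real_atLeast)
    then have "(v has_vector_derivative F (v s)) (at s)"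
      using v s unfolding is_solution_on_def by (metis atLeast_iff less_imp_le)
    moreover have Ws: "(W has_derivative W' (v s)) (at (v s))"
      using s by (intro W N) auto
    ultimately have "((\<lambda>s. W (v s)) has_derivative (\<lambda>h. W' (v s) (h *\<^sub>R F (v s)))) (at s)"
      unfolding has_vector_derivative_def by (rule has_derivative_compose)
    moreover have "(\<lambda>h. W' (v s) (h *\<^sub>R F (v s))) = (*) (W' (v s) (F (v s)))"
      using linear_scale[OF has_derivative_linear[OF Ws]] by auto
    ultimately show "((\<lambda>s. W (v s)) has_real_derivative W' (v s) (F (v s))) (at s)"
      by (simp add: has_field_derivative_def)
    show "W' (v s) (F (v s)) \<le> k * W (v s)"
      using le[OF N] s by simp
  qed
  then show ?thesis by simp
qed

lemma positive_on_shell_lower_bound: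
  fixes \<Gamma> :: "'a::heine_borel set"
  assumes "\<Gamma> \<noteq> {}" "compact \<Gamma>" "0 < \<eta>" "\<eta> \<le> \<rho>"
    and W: "continuous_on {p. infdist p \<Gamma> \<le> \<rho>} W"
    and pos: "\<And>p. 0 < infdist p \<Gamma> \<Longrightarrow> infdist p \<Gamma> \<le> \<rho> \<Longrightarrow> W p > (0::real)"
  obtains m where "m > 0" "\<And>p. \<eta> \<le> infdist p \<Gamma> \<Longrightarrow> infdist p \<Gamma> \<le> \<rho> \<Longrightarrow> m \<le> W p"
proof -
  define S where "S = {p. infdist p \<Gamma> \<le> \<rho>} \<inter> {p. \<eta> \<le> infdist p \<Gamma>}"
  have "closed {p. \<eta> \<le> infdist p \<Gamma>}"
    by (intro closed_Collect_le continuous_intros)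
  moreover have "compact {p. infdist p \<Gamma> \<le> \<rho>}"
    using assms by (intro compact_infdist_le) auto
  ultimately have "compact S" unfolding S_def by (rule compact_Int_closed[rotated])
  show ?thesis
  proof (cases "S = {}")
    case True
    then show ?thesis using that[of 1] by (auto simp: S_def)
  next
    case False
    have "continuous_on S W"
      using W by (rule continuous_on_subset) (auto simp: S_def)
    then obtain q where "q \<in> S" "\<And>p. p \<in> S \<Longrightarrow> W q \<le> W p"
      using continuous_attains_inf[OF \<open>compact S\<close> False] by blast
    then show ?thesis
      using that[of "W q"] pos[of q] \<open>0 < \<eta>\<close> by (auto simp: S_def)
  qed
qed

lemma small_near_zero_set:
  fixes g :: "'a::heine_borel \<Rightarrow> real"
  assumes "\<Gamma> \<noteq> {}" "compact \<Gamma>" "continuous_on UNIV g" "\<And>p. p \<in> \<Gamma> \<Longrightarrow> g p = 0" "e > 0"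
  obtains \<rho> where "\<rho> > 0" "\<And>p. infdist p \<Gamma> \<le> \<rho> \<Longrightarrow> \<bar>g p\<bar> < e"
proof -
  have "open {p. \<bar>g p\<bar> < e}"
    using assms by (intro open_Collect_less continuous_intros)
  moreover have "\<Gamma> \<subseteq> {p. \<bar>g p\<bar> < e}" using assms by auto
  ultimately obtain \<rho> where "\<rho> > 0" "{p. infdist p \<Gamma> \<le> \<rho>} \<subseteq> {p. \<bar>g p\<bar> < e}"
    using compact_in_open_separated[OF assms(1,2)] by blast
  then show ?thesis using that by blast
qed

text \<open>The properties of \<open>W\<close> that refer to the set \<open>\<Gamma>\<close> alone. No vector field is fixed here, because the
existence part of stability applies them to a truncation of the field under study; \<open>W' p h\<close> is the
derivative of \<open>W\<close> at \<open>p\<close> in direction \<open>h\<close>, so \<open>W' p (F p)\<close> is the rate of change along \<open>F\<close>.\<close>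

locale lyapunov_candidate =
  fixes \<Gamma> :: "'a::euclidean_space set" and W :: "'a \<Rightarrow> real" and W' :: "'a \<Rightarrow> 'a \<Rightarrow> real" and \<rho> c :: real
  assumes nonempty: "\<Gamma> \<noteq> {}" and compact: "compact \<Gamma>" and \<rho>: "\<rho> > 0" and c: "c > 0"
    and deriv: "\<And>p. infdist p \<Gamma> \<le> \<rho> \<Longrightarrow> (W has_derivative W' p) (at p)"
    and zero: "\<And>p. p \<in> \<Gamma> \<Longrightarrow> W p = 0"
    and pos: "\<And>p. 0 < infdist p \<Gamma> \<Longrightarrow> infdist p \<Gamma> \<le> \<rho> \<Longrightarrow> W p > 0"
begin

lemma cont: "continuous_on {p. infdist p \<Gamma> \<le> \<rho>} W"
  by (intro continuous_at_imp_continuous_on ballI has_derivative_continuous[OF deriv]) simp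

lemma nonneg: "infdist p \<Gamma> \<le> \<rho> \<Longrightarrow> W p \<ge> 0"
  using zero[of p] pos[of p] in_closed_iff_infdist_zero[OF compact_imp_closed[OF compact] nonempty, of p]
    infdist_nonneg[of p \<Gamma>] by force

text \<open>The barrier argument: on the sphere \<open>infdist p \<Gamma> = \<eta>\<close> the function \<open>W\<close> is at least \<open>m\<close>, but up to the
first hitting time of that sphere it has only decreased from a value below \<open>m\<close>.\<close>

lemma stays_close:
  assumes v: "is_solution_on F v {0..}"
    and le: "\<And>p. infdist p \<Gamma> \<le> \<rho> \<Longrightarrow> W' p (F p) \<le> - c * W p"
    and \<eta>: "\<eta> \<le> \<rho>" "infdist (v 0) \<Gamma> < \<eta>"
    and m: "\<And>p. infdist p \<Gamma> = \<eta> \<Longrightarrow> m \<le> W p" "W (v 0) < m"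
    and "t \<ge> 0"
  shows "infdist (v t) \<Gamma> < \<eta>" "W (v t) \<le> W (v 0) * exp (- c * t)"
proof -
  have decay: "W (v t) \<le> W (v 0) * exp (- c * t)"
    if "t \<ge> 0" "\<And>s. 0 \<le> s \<Longrightarrow> s \<le> t \<Longrightarrow> infdist (v s) \<Gamma> \<le> \<eta>" for t
    using growth_along_solution[OF v \<open>t \<ge> 0\<close>, of "{p. infdist p \<Gamma> \<le> \<rho>}" W W' "- c"]
      deriv le that \<eta> by force
  have cont_dist: "continuous_on {0..t} (\<lambda>s. infdist (v s) \<Gamma>)" for t
    by (intro continuous_intros continuous_on_subset[OF is_solution_on_imp_continuous_on[OF v]]) auto
  have close: "infdist (v t) \<Gamma> < \<eta>" if "t \<ge> 0" for t
  proof (rule ccontr)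
    assume "\<not> infdist (v t) \<Gamma> < \<eta>"
    define A where "A = {0..t} \<inter> (\<lambda>s. infdist (v s) \<Gamma>) -` {\<eta>..}"
    have "closed A"
      unfolding A_def
      by (rule continuous_closed_preimage[OF cont_dist closed_real_atLeastAtMost closed_atLeast])
    moreover have "bounded A" unfolding A_def by (intro bounded_Int disjI1 bounded_closed_interval)
    ultimately have "compact A" by (simp add: compact_eq_bounded_closed)
    moreover have "t \<in> A" using \<open>\<not> _\<close> that by (simp add: A_def)
    \<comment> \<open>\<open>r\<close> is the first time at which the solution reaches the sphere of radius \<open>\<eta>\<close>\<close>
    ultimately obtain r where r: "r \<in> A" "\<And>s. s \<in> A \<Longrightarrow> r \<le> s"
      using compact_attains_inf[of A] by blast
    then have "0 \<le> r" "r \<le> t" and ge: "infdist (v r) \<Gamma> \<ge> \<eta>" by (auto simp: A_def)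
    have before: "infdist (v s) \<Gamma> < \<eta>" if "0 \<le> s" "s < r" for s
      using r(2)[of s] that \<open>r \<le> t\<close> by (force simp: A_def)
    have "\<exists>x\<ge>0. x \<le> r \<and> infdist (v x) \<Gamma> = \<eta>"
      using IVT'[of "\<lambda>s. infdist (v s) \<Gamma>" 0 \<eta> r] \<eta> ge \<open>0 \<le> r\<close> cont_dist by auto
    then have eq: "infdist (v r) \<Gamma> = \<eta>" using before by (metis less_irrefl order_le_less)
    have "m \<le> W (v r)" by (rule m(1)[OF eq])
    also have "\<dots> \<le> W (v 0) * exp (- c * r)"
      using before eq \<open>0 \<le> r\<close> by (intro decay) (auto simp: order_le_less)
    also have "\<dots> \<le> W (v 0)"
      using \<open>0 \<le> r\<close> c nonneg[of "v 0"] \<eta> by (simp add: mult_left_le)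
    finally show False using m(2) by simp
  qed
  show "infdist (v t) \<Gamma> < \<eta>" using \<open>t \<ge> 0\<close> by (rule close)
  show "W (v t) \<le> W (v 0) * exp (- c * t)"
    using decay[OF \<open>t \<ge> 0\<close>] close by (simp add: less_imp_le)
qed

lemma trapping_radius:
  assumes "\<eta> > 0" "\<eta> \<le> \<rho>"
  obtains \<delta> m where "\<delta> > 0" "\<delta> \<le> \<eta>" "\<And>p. infdist p \<Gamma> = \<eta> \<Longrightarrow> m \<le> W p"
    "\<And>p. infdist p \<Gamma> < \<delta> \<Longrightarrow> W p < m"
proof -
  obtain m where m: "m > 0" "\<And>p. \<eta> \<le> infdist p \<Gamma> \<Longrightarrow> infdist p \<Gamma> \<le> \<rho> \<Longrightarrow> m \<le> W p"
    using positive_on_shell_lower_bound[OF nonempty compact assms cont pos] by blast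
  let ?U = "{p. infdist p \<Gamma> < \<rho>}"
  have U: "open ?U" by (intro open_Collect_less continuous_intros)
  have "continuous_on ?U W" using cont by (rule continuous_on_subset) auto
  then have "open (?U \<inter> W -` {..<m})"
    using U open_lessThan by (rule continuous_open_preimage)
  moreover have "\<Gamma> \<subseteq> ?U \<inter> W -` {..<m}"
    using zero m(1) \<rho> by auto
  ultimately obtain \<delta> where "\<delta> > 0" "{p. infdist p \<Gamma> \<le> \<delta>} \<subseteq> ?U \<inter> W -` {..<m}"
    using compact_in_open_separated[OF nonempty compact] by blast
  then show ?thesis
    using that[of "min \<delta> \<eta>" m] m assms by (force simp: subset_iff)
qed

text \<open>A solution that starts close to \<open>\<Gamma>\<close> is trapped by the barrier argument, and \<open>W\<close> decays
exponentially along it; as \<open>W\<close> has a positive minimum on every shell around \<open>\<Gamma>\<close>, the distance to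
\<open>\<Gamma>\<close> tends to \<open>0\<close>. Existence for all forward time comes from the same trap: the field composed with the
projection onto a large box is globally Lipschitz, and its solution never leaves the region in which
both fields agree.\<close>

theorem exponential_decrease_imp_orbitally_asymptotically_stable:
  assumes le: "\<And>p. infdist p \<Gamma> \<le> \<rho> \<Longrightarrow> W' p (F p) \<le> - c * W p"
    and lip: "\<And>a b. \<exists>L. L-lipschitz_on (cbox a b) F"
  shows "orbitally_asymptotically_stable F \<Gamma>"
  unfolding orbitally_asymptotically_stable_def orbitally_stable_def
proof (intro conjI allI impI)
  fix \<eta> :: real assume "\<eta> > 0"
  define \<eta>' where "\<eta>' = min \<eta> \<rho>"
  have \<eta>': "\<eta>' > 0" "\<eta>' \<le> \<rho>" "\<eta>' \<le> \<eta>" using \<open>\<eta> > 0\<close> \<rho> by (auto simp: \<eta>'_def)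
  obtain \<delta> m where \<delta>: "\<delta> > 0" "\<delta> \<le> \<eta>'" and m: "\<And>p. infdist p \<Gamma> = \<eta>' \<Longrightarrow> m \<le> W p"
    "\<And>p. infdist p \<Gamma> < \<delta> \<Longrightarrow> W p < m"
    using trapping_radius[OF \<eta>'(1,2)] by metis
  have "\<exists>v. is_solution_on F v {0..} \<and> v 0 = p" if p: "infdist p \<Gamma> < \<delta>" for p
  proof -
    have "bounded {p. infdist p \<Gamma> \<le> \<rho>}"
      using compact_infdist_le[OF nonempty compact \<rho>] by (rule compact_imp_bounded)
    then obtain b where b: "{p. infdist p \<Gamma> \<le> \<rho>} \<subseteq> cbox (- b) b"
      by (rule bounded_subset_cbox_symmetric)
    define G where "G p = F (clamp (- b) b p)" for p
    have G: "G p = F p" if "infdist p \<Gamma> \<le> \<rho>" for p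
      using b that by (auto simp: G_def)
    have "infdist p \<Gamma> \<le> \<rho>" using p \<delta> \<eta>' by linarith
    then have "cbox (- b) b \<noteq> {}" using b by blast
    then have "range (clamp (- b) b) \<subseteq> cbox (- b) b"
      by (auto intro!: clamp_in_interval simp: box_ne_empty)
    moreover obtain L where "L-lipschitz_on (cbox (- b) b) F" using lip by blast
    ultimately have "L-lipschitz_on (range (clamp (- b) b)) F"
      by (rule lipschitz_on_subset[rotated])
    moreover have "1-lipschitz_on UNIV (clamp (- b) b)"
      by (rule lipschitz_onI) (auto simp: dist_clamps_le_dist_args)
    ultimately have "L-lipschitz_on UNIV G"
      unfolding G_def using lipschitz_on_compose2[of 1 UNIV "clamp (- b) b" L F] by simp
    from lipschitz_field_has_forward_solution[OF this]
    obtain v where v: "is_solution_on G v {0..}" "v 0 = p" by blast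
    have "infdist (v t) \<Gamma> < \<eta>'" if "t \<ge> 0" for t
      using stays_close(1)[OF v(1) _ \<eta>'(2) _ m(1) _ that] le G m(2)[of p] p v(2) \<delta> by auto
    then have "is_solution_on F v {0..}"
      using v(1) G \<eta>' unfolding is_solution_on_def by (metis atLeast_iff less_imp_le order_trans)
    then show ?thesis using v(2) by blast
  qed
  moreover have "infdist (v t) \<Gamma> < \<eta>"
    if "infdist (v 0) \<Gamma> < \<delta>" "is_solution_on F v {0..}" "t \<ge> 0" for v t
    using stays_close(1)[OF that(2) le \<eta>'(2) _ m(1) m(2)[OF that(1)] that(3)] that \<delta> \<eta>' by auto
  ultimately show "\<exists>\<delta>>0. \<forall>p. infdist p \<Gamma> < \<delta> \<longrightarrow>
      (\<exists>v. is_solution_on F v {0..} \<and> v 0 = p) \<and>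
      (\<forall>v. is_solution_on F v {0..} \<and> v 0 = p \<longrightarrow> (\<forall>t\<ge>0. infdist (v t) \<Gamma> < \<eta>))"
    using \<open>\<delta> > 0\<close> by blast
next
  obtain \<delta> m where \<delta>: "\<delta> > 0" "\<delta> \<le> \<rho>" and m: "\<And>p. infdist p \<Gamma> = \<rho> \<Longrightarrow> m \<le> W p"
    "\<And>p. infdist p \<Gamma> < \<delta> \<Longrightarrow> W p < m"
    using trapping_radius[OF \<rho> order_refl] by metis
  have "((\<lambda>t. infdist (v t) \<Gamma>) \<longlongrightarrow> 0) at_top"
    if v: "is_solution_on F v {0..}" and close: "infdist (v 0) \<Gamma> < \<delta>" for v
  proof (rule tendstoI)
    fix e :: real assume "e > 0"
    have trapped: "infdist (v t) \<Gamma> < \<rho>" "W (v t) \<le> W (v 0) * exp (- c * t)" if "t \<ge> 0" for t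
      using stays_close[OF v le order_refl _ m(1) m(2)[OF close] that] close \<delta> by auto
    have "min e \<rho> > 0" "min e \<rho> \<le> \<rho>" using \<open>e > 0\<close> \<rho> by auto
    then obtain k where k: "k > 0" "\<And>p. min e \<rho> \<le> infdist p \<Gamma> \<Longrightarrow> infdist p \<Gamma> \<le> \<rho> \<Longrightarrow> k \<le> W p"
      using positive_on_shell_lower_bound[OF nonempty compact _ _ cont pos] by metis
    have "((\<lambda>t. W (v 0) * exp (- c * t)) \<longlongrightarrow> W (v 0) * 0) at_top"
      using c by (intro tendsto_mult tendsto_const) real_asymp
    then have "\<forall>\<^sub>F t in at_top. W (v 0) * exp (- c * t) < k"
      using k(1) by (intro order_tendstoD) auto
    then show "\<forall>\<^sub>F t in at_top. dist (infdist (v t) \<Gamma>) 0 < e"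
      using eventually_ge_at_top[of "0::real"]
    proof eventually_elim
      case (elim t)
      then have "W (v t) < k" using trapped(2)[of t] by simp
      then have "\<not> min e \<rho> \<le> infdist (v t) \<Gamma>" using k(2)[of "v t"] trapped(1)[of t] elim by auto
      then show ?case using trapped(1)[of t] elim infdist_nonneg[of "v t" \<Gamma>] by auto
    qed
  qed
  then show "\<exists>\<delta>>0. \<forall>v. is_solution_on F v {0..} \<and> infdist (v 0) \<Gamma> < \<delta> \<longrightarrow>
      ((\<lambda>t. infdist (v t) \<Gamma>) \<longlongrightarrow> 0) at_top"
    using \<delta> by blast
qed

text \<open>Stability would keep a solution that starts off \<open>\<Gamma>\<close> forever in a compact neighbourhood, where \<open>W\<close> is
bounded, although \<open>W\<close> grows exponentially along it from a positive value.\<close>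

theorem exponential_increase_imp_orbitally_unstable:
  assumes ge: "\<And>p. infdist p \<Gamma> \<le> \<rho> \<Longrightarrow> W' p (F p) \<ge> c * W p"
    and near: "\<And>\<delta>. \<delta> > 0 \<Longrightarrow> \<exists>p. 0 < infdist p \<Gamma> \<and> infdist p \<Gamma> < \<delta>"
  shows "orbitally_unstable F \<Gamma>"
  unfolding orbitally_unstable_def
proof
  assume "orbitally_stable F \<Gamma>"
  then obtain \<delta> where "\<delta> > 0" and \<delta>: "\<And>p. infdist p \<Gamma> < \<delta> \<Longrightarrow>
      (\<exists>v. is_solution_on F v {0..} \<and> v 0 = p) \<and>
      (\<forall>v. is_solution_on F v {0..} \<and> v 0 = p \<longrightarrow> (\<forall>t\<ge>0. infdist (v t) \<Gamma> < \<rho>))"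
    unfolding orbitally_stable_def using \<rho> by blast
  obtain p where p: "0 < infdist p \<Gamma>" "infdist p \<Gamma> < \<delta>" using near[OF \<open>\<delta> > 0\<close>] by blast
  obtain v where v: "is_solution_on F v {0..}" "v 0 = p" using \<delta>[OF p(2)] by blast
  then have close: "infdist (v t) \<Gamma> < \<rho>" if "t \<ge> 0" for t using \<delta>[OF p(2)] that by blast
  have Wp: "W p > 0" using pos[OF p(1)] close[of 0] v(2) by simp
  obtain B where B: "\<And>q. infdist q \<Gamma> \<le> \<rho> \<Longrightarrow> norm (W q) \<le> B"
    using compact_imp_bounded[OF compact_continuous_image[OF cont compact_infdist_le[OF nonempty compact \<rho>]]]
    unfolding bounded_iff by auto
  have growth: "W p * exp (c * t) \<le> B" if "t \<ge> 0" for t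
  proof -
    have "- W (v t) \<le> - W (v 0) * exp (c * t)"
    proof (rule growth_along_solution[OF v(1) that])
      show "v s \<in> {p. infdist p \<Gamma> \<le> \<rho>}" if "0 \<le> s" for s
        using close[OF that] by simp
      show "((\<lambda>p. - W p) has_derivative (\<lambda>h. - W' q h)) (at q)"
        if "q \<in> {p. infdist p \<Gamma> \<le> \<rho>}" for q
        using that by (intro has_derivative_minus deriv) simp
      show "- W' q (F q) \<le> c * - W q" if "q \<in> {p. infdist p \<Gamma> \<le> \<rho>}" for q
        using ge[of q] that by simp
    qed
    then show ?thesis using B[of "v t"] close[OF that] v(2) by auto
  qed
  have "filterlim (\<lambda>t. W p * exp (c * t)) at_top at_top"
    using Wp c by real_asymp
  then have "\<forall>\<^sub>F t in at_top. B < W p * exp (c * t)"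
    by (simp add: filterlim_at_top_dense)
  then have "\<forall>\<^sub>F t::real in at_top. False"
    using eventually_ge_at_top[of "0::real"]
    by eventually_elim (use growth in force)
  then show False by simp
qed

end

section \<open>The field and its planar reduction\<close>

lemma lipschitz_on_mult_compact:
  fixes f g :: "'a::metric_space \<Rightarrow> real"
  assumes "compact X" and f: "\<exists>C. C-lipschitz_on X f" and g: "\<exists>D. D-lipschitz_on X g"
  shows "\<exists>E. E-lipschitz_on X (\<lambda>x. f x * g x)"
proof -
  obtain C D where C: "C-lipschitz_on X f" and D: "D-lipschitz_on X g" using f g by blast
  have "bounded (f ` X)" "bounded (g ` X)"
    using C D \<open>compact X\<close>
    by (auto intro!: compact_imp_bounded compact_continuous_image lipschitz_on_continuous_on)
  then obtain a b where a: "\<And>x. x \<in> X \<Longrightarrow> \<bar>f x\<bar> \<le> a" "a > 0" and b: "\<And>x. x \<in> X \<Longrightarrow> \<bar>g x\<bar> \<le> b" "b > 0"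
    unfolding bounded_pos by auto
  have "(a * D + b * C)-lipschitz_on X (\<lambda>x. f x * g x)"
  proof (rule lipschitz_onI)
    show "0 \<le> a * D + b * C"
      using a b lipschitz_on_nonneg[OF C] lipschitz_on_nonneg[OF D] by simp
    fix x y assume x: "x \<in> X" and y: "y \<in> X"
    have "dist (f x * g x) (f y * g y) = \<bar>f x * (g x - g y) + g y * (f x - f y)\<bar>"
      by (simp add: dist_real_def algebra_simps)
    also have "\<dots> \<le> \<bar>f x\<bar> * dist (g x) (g y) + \<bar>g y\<bar> * dist (f x) (f y)"
      by (metis abs_mult abs_triangle_ineq dist_real_def)
    also have "\<dots> \<le> a * (D * dist x y) + b * (C * dist x y)"
      using a b x y lipschitz_onD[OF C x y] lipschitz_onD[OF D x y]
      by (intro add_mono mult_mono) auto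
    finally show "dist (f x * g x) (f y * g y) \<le> (a * D + b * C) * dist x y"
      by (simp add: algebra_simps)
  qed
  then show ?thesis by blast
qed

lemma lipschitz_zero_hopf_field:
  assumes X: "compact X"
  shows "\<exists>L. L-lipschitz_on X (zero_hopf_field \<alpha> \<beta> \<gamma> \<mu>)"
proof -
  let ?lip = "\<lambda>f::real3 \<Rightarrow> real. \<exists>C. C-lipschitz_on X f"
  have add: "?lip (\<lambda>p. f p + g p)" if "?lip f" "?lip g" for f g
    using that lipschitz_on_add by blast
  have diff: "?lip (\<lambda>p. f p - g p)" if "?lip f" "?lip g" for f g
    using that lipschitz_on_diff by blast
  have const: "?lip (\<lambda>p. c)" for c using lipschitz_on_constant by blast
  note mult = lipschitz_on_mult_compact[OF X]
  have "1-lipschitz_on X (\<lambda>p::real3. fst p)"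
    by (rule lipschitz_onI) (auto simp: dist_fst_le)
  moreover have "1-lipschitz_on X (\<lambda>p::real3. fst (snd p))"
    by (rule lipschitz_onI) (use order_trans[OF dist_fst_le dist_snd_le] in auto)
  moreover have "1-lipschitz_on X (\<lambda>p::real3. snd (snd p))"
    by (rule lipschitz_onI) (use order_trans[OF dist_snd_le dist_snd_le] in auto)
  ultimately have proj: "?lip fst" "?lip (\<lambda>p. fst (snd p))" "?lip (\<lambda>p. snd (snd p))" by blast+
  have "?lip (\<lambda>p. fst (zero_hopf_field \<alpha> \<beta> \<gamma> \<mu> p))"
    "?lip (\<lambda>p. fst (snd (zero_hopf_field \<alpha> \<beta> \<gamma> \<mu> p)))"
    "?lip (\<lambda>p. snd (snd (zero_hopf_field \<alpha> \<beta> \<gamma> \<mu> p)))"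
    unfolding zero_hopf_field_def case_prod_beta fst_conv snd_conv power2_eq_square
    by (intro add diff mult const proj)+
  then obtain A B C where "A-lipschitz_on X (\<lambda>p. fst (zero_hopf_field \<alpha> \<beta> \<gamma> \<mu> p))"
    "B-lipschitz_on X (\<lambda>p. fst (snd (zero_hopf_field \<alpha> \<beta> \<gamma> \<mu> p)))"
    "C-lipschitz_on X (\<lambda>p. snd (snd (zero_hopf_field \<alpha> \<beta> \<gamma> \<mu> p)))" by blast
  from lipschitz_on_Pair[OF this(1) lipschitz_on_Pair[OF this(2,3)]]
  show ?thesis by auto
qed

text \<open>In the variables \<open>\<sigma> = x\<^sup>2 + y\<^sup>2 - s\<close> and \<open>w = z - \<zeta>\<close>, centred at an invariant circle of squared
radius \<open>s\<close> and height \<open>\<zeta>\<close>, the system reads \<open>\<sigma>' = 2 * (\<sigma> + s) * w\<close> and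
\<open>w' = \<tau> * w - \<gamma> * \<sigma> - \<gamma> * w\<^sup>2\<close>, a damped or driven nonlinear oscillator. The first two summands of
\<open>twisted_energy\<close> are conserved by its linear part for \<open>\<tau> = 0\<close>; in general their rate of change is
\<open>\<tau> * w\<^sup>2\<close> up to cubic terms and thus degenerate in \<open>\<sigma>\<close>. The cross term repairs this.\<close>

definition twisted_energy :: "real \<Rightarrow> real \<Rightarrow> real \<Rightarrow> real \<Rightarrow> real \<Rightarrow> real" where
  "twisted_energy \<gamma> s \<kappa> \<sigma> w = \<gamma> / (4 * s) * \<sigma>\<^sup>2 + w\<^sup>2 / 2 - \<kappa> * \<sigma> * w"

text \<open>The derivative of \<open>twisted_energy\<close> along that planar system, by the chain rule.\<close>

definition twisted_energy_rate :: "real \<Rightarrow> real \<Rightarrow> real \<Rightarrow> real \<Rightarrow> real \<Rightarrow> real \<Rightarrow> real" where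
  "twisted_energy_rate \<gamma> s \<tau> \<kappa> \<sigma> w =
     (\<gamma> / (2 * s) * \<sigma> - \<kappa> * w) * (2 * (\<sigma> + s) * w) + (w - \<kappa> * \<sigma>) * (\<tau> * w - \<gamma> * \<sigma> - \<gamma> * w\<^sup>2)"

text \<open>With \<open>\<kappa> = k * \<tau>\<close>, the quadratic part of the rate is \<open>\<tau>\<close> times the form
\<open>(1 - 2 * k * s) * w\<^sup>2 - k * \<tau> * \<sigma> * w + k * \<gamma> * \<sigma>\<^sup>2\<close>. For small \<open>k > 0\<close> both this form and the
energy are positive definite, and near the origin the cubic remainder is negligible. Choosing the
cross term proportional to \<open>\<tau>\<close> treats both signs of \<open>\<tau>\<close> at once.\<close>

lemma twisted_energy_estimates:
  fixes \<gamma> s \<tau> :: real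
  assumes \<gamma>: "\<gamma> > 0" and s: "s > 0" and \<tau>: "\<tau> \<noteq> 0"
  obtains c e \<kappa> where "c > 0" "e > 0"
    "\<And>\<sigma> w. \<sigma> \<noteq> 0 \<or> w \<noteq> 0 \<Longrightarrow> twisted_energy \<gamma> s \<kappa> \<sigma> w > 0"
    "\<And>\<sigma> w. \<bar>\<sigma>\<bar> < e \<Longrightarrow> \<bar>w\<bar> < e \<Longrightarrow>
       c * twisted_energy \<gamma> s \<kappa> \<sigma> w \<le> sgn \<tau> * twisted_energy_rate \<gamma> s \<tau> \<kappa> \<sigma> w"
proof -
  \<comment> \<open>the two bounds give \<open>1 - 2 * k * s \<ge> 1 / 2\<close> and make \<open>k * \<tau> * \<sigma> * w\<close> a small cross term\<close>
  define k where "k = min (1 / (4 * s)) (\<gamma> / (2 * \<tau>\<^sup>2))"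
  have k: "k > 0" using \<gamma> s \<tau> by (simp add: k_def)
  have "k \<le> 1 / (4 * s)" "k \<le> \<gamma> / (2 * \<tau>\<^sup>2)" by (auto simp: k_def)
  then have ks: "k * s \<le> 1 / 4" and k\<tau>: "k * \<tau>\<^sup>2 \<le> \<gamma> / 2"
    using s \<tau> by (auto simp: field_simps)
  have cross: "\<bar>k * \<tau> * \<sigma> * w\<bar> \<le> k * \<gamma> / 2 * \<sigma>\<^sup>2 + w\<^sup>2 / 4" for \<sigma> w
  proof -
    have "\<bar>(\<gamma> * \<sigma>) * (\<tau> * w)\<bar> \<le> ((\<gamma> * \<sigma>)\<^sup>2 + (\<tau> * w)\<^sup>2) / 2"
      using sum_squares_bound[of "\<bar>\<gamma> * \<sigma>\<bar>" "\<bar>\<tau> * w\<bar>"]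
      by (simp add: abs_mult power_mult_distrib)
    then have "k / \<gamma> * \<bar>(\<gamma> * \<sigma>) * (\<tau> * w)\<bar> \<le> k / \<gamma> * (((\<gamma> * \<sigma>)\<^sup>2 + (\<tau> * w)\<^sup>2) / 2)"
      using k \<gamma> by (intro mult_left_mono) auto
    moreover have "k / \<gamma> * \<bar>(\<gamma> * \<sigma>) * (\<tau> * w)\<bar> = \<bar>k * \<tau> * \<sigma> * w\<bar>"
      using k \<gamma> by (simp add: abs_mult)
    moreover have "k / \<gamma> * (((\<gamma> * \<sigma>)\<^sup>2 + (\<tau> * w)\<^sup>2) / 2) = k * \<gamma> / 2 * \<sigma>\<^sup>2 + (k * \<tau>\<^sup>2) / (2 * \<gamma>) * w\<^sup>2"
      using \<gamma> by (simp add: field_simps power2_eq_square)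
    moreover have "(k * \<tau>\<^sup>2) / (2 * \<gamma>) * w\<^sup>2 \<le> 1 / 4 * w\<^sup>2"
      using k\<tau> \<gamma> by (intro mult_right_mono) (auto simp: field_simps)
    ultimately show ?thesis by linarith
  qed
  have posdef: "twisted_energy \<gamma> s (k * \<tau>) \<sigma> w \<ge> \<gamma> / (8 * s) * \<sigma>\<^sup>2 + w\<^sup>2 / 4" for \<sigma> w
  proof -
    have "k * \<gamma> / 2 * \<sigma>\<^sup>2 \<le> \<gamma> / (8 * s) * \<sigma>\<^sup>2"
      using ks \<gamma> s by (intro mult_right_mono) (auto simp: field_simps)
    moreover have "\<gamma> / (4 * s) * \<sigma>\<^sup>2 = 2 * (\<gamma> / (8 * s) * \<sigma>\<^sup>2)" by simp
    ultimately show ?thesis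
      using abs_le_D1[OF cross[of \<sigma> w]] unfolding twisted_energy_def by linarith
  qed
  define M where "M = \<gamma> / (4 * s) + 1 / 2 + k * \<gamma> / 2 + 1 / 4"
  have M: "M > 0" using \<gamma> s k by (simp add: M_def add_pos_pos)
  have upper: "twisted_energy \<gamma> s (k * \<tau>) \<sigma> w \<le> M * (\<sigma>\<^sup>2 + w\<^sup>2)" for \<sigma> w
  proof -
    have "twisted_energy \<gamma> s (k * \<tau>) \<sigma> w \<le> (\<gamma> / (4 * s) + k * \<gamma> / 2) * \<sigma>\<^sup>2 + (1 / 2 + 1 / 4) * w\<^sup>2"
      using cross[of \<sigma> w] unfolding twisted_energy_def
      by (simp add: algebra_simps abs_le_iff)
    also have "\<dots> \<le> M * \<sigma>\<^sup>2 + M * w\<^sup>2"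
      using \<gamma> s k by (intro add_mono mult_right_mono) (auto simp: M_def)
    finally show ?thesis by (simp add: algebra_simps)
  qed
  define q where "q = min (1 / 4) (k * \<gamma> / 2)"
  have q: "q > 0" using k \<gamma> by (simp add: q_def)
  \<comment> \<open>the cubic part of the rate\<close>
  define R where "R \<sigma> w = \<gamma> / s * w * \<sigma>\<^sup>2 - (2 * (k * \<tau>) * \<sigma> + \<gamma> * w - k * \<tau> * \<gamma> * \<sigma>) * w\<^sup>2" for \<sigma> w
  define C where "C = \<gamma> / s + (2 * (k * \<bar>\<tau>\<bar>) + \<gamma> + k * \<bar>\<tau>\<bar> * \<gamma>)"
  have C: "C > 0" using \<gamma> s k unfolding C_def by (intro add_pos_nonneg add_nonneg_nonneg) auto
  have R: "\<bar>R \<sigma> w\<bar> \<le> C * e * (\<sigma>\<^sup>2 + w\<^sup>2)" if "\<bar>\<sigma>\<bar> \<le> e" "\<bar>w\<bar> \<le> e" for \<sigma> w e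
  proof -
    have "e \<ge> 0" using that by linarith
    have "\<bar>2 * (k * \<tau>) * \<sigma> + \<gamma> * w - k * \<tau> * \<gamma> * \<sigma>\<bar>
        \<le> 2 * (k * \<bar>\<tau>\<bar>) * \<bar>\<sigma>\<bar> + \<gamma> * \<bar>w\<bar> + k * \<bar>\<tau>\<bar> * \<gamma> * \<bar>\<sigma>\<bar>"
      using k \<gamma> by (intro abs_triangle_ineq4[THEN order_trans] add_mono abs_triangle_ineq[THEN order_trans])
        (auto simp: abs_mult)
    also have "\<dots> \<le> 2 * (k * \<bar>\<tau>\<bar>) * e + \<gamma> * e + k * \<bar>\<tau>\<bar> * \<gamma> * e"
      using that k \<gamma> by (intro add_mono mult_left_mono) auto
    finally have 1: "\<bar>2 * (k * \<tau>) * \<sigma> + \<gamma> * w - k * \<tau> * \<gamma> * \<sigma>\<bar> \<le> (C - \<gamma> / s) * e"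
      by (simp add: C_def algebra_simps)
    have "\<bar>R \<sigma> w\<bar> \<le> \<bar>\<gamma> / s * w * \<sigma>\<^sup>2\<bar> + \<bar>(2 * (k * \<tau>) * \<sigma> + \<gamma> * w - k * \<tau> * \<gamma> * \<sigma>) * w\<^sup>2\<bar>"
      unfolding R_def by (rule abs_triangle_ineq4)
    also have "\<dots> = \<gamma> / s * \<bar>w\<bar> * \<sigma>\<^sup>2 + \<bar>2 * (k * \<tau>) * \<sigma> + \<gamma> * w - k * \<tau> * \<gamma> * \<sigma>\<bar> * w\<^sup>2"
      using \<gamma> s by (simp add: abs_mult)
    also have "\<dots> \<le> \<gamma> / s * e * \<sigma>\<^sup>2 + (C - \<gamma> / s) * e * w\<^sup>2"
      using that \<gamma> s 1 by (intro add_mono mult_right_mono mult_left_mono) auto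
    also have "\<dots> \<le> C * e * \<sigma>\<^sup>2 + C * e * w\<^sup>2"
      using \<gamma> s k \<open>e \<ge> 0\<close> by (intro add_mono mult_right_mono) (auto simp: C_def)
    finally show ?thesis by (simp add: algebra_simps)
  qed
  \<comment> \<open>for \<open>\<bar>\<sigma>\<bar>, \<bar>w\<bar> < e\<close> the remainder costs at most half of the lower bound \<open>\<bar>\<tau>\<bar> * q * (\<sigma>\<^sup>2 + w\<^sup>2)\<close>\<close>
  define e where "e = \<bar>\<tau>\<bar> * q / (2 * C)"
  define c where "c = \<bar>\<tau>\<bar> * q / (2 * M)"
  have e: "e > 0" and c: "c > 0" using q C M \<tau> by (auto simp: e_def c_def)
  have rate: "c * twisted_energy \<gamma> s (k * \<tau>) \<sigma> w \<le> sgn \<tau> * twisted_energy_rate \<gamma> s \<tau> (k * \<tau>) \<sigma> w"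
    if "\<bar>\<sigma>\<bar> < e" "\<bar>w\<bar> < e" for \<sigma> w
  proof -
    define Q where "Q = (1 - 2 * k * s) * w\<^sup>2 - k * \<tau> * \<sigma> * w + k * \<gamma> * \<sigma>\<^sup>2"
    have "twisted_energy_rate \<gamma> s \<tau> (k * \<tau>) \<sigma> w = \<tau> * Q + R \<sigma> w"
      using s unfolding twisted_energy_rate_def Q_def R_def
      by (simp add: field_simps power2_eq_square)
    then have split: "sgn \<tau> * twisted_energy_rate \<gamma> s \<tau> (k * \<tau>) \<sigma> w = \<bar>\<tau>\<bar> * Q + sgn \<tau> * R \<sigma> w"
      by (simp add: algebra_simps sgn_mult_self_eq abs_sgn)
    have "(1 / 2) * w\<^sup>2 \<le> (1 - 2 * k * s) * w\<^sup>2"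
      using ks by (intro mult_right_mono) auto
    then have "1 / 4 * w\<^sup>2 + k * \<gamma> / 2 * \<sigma>\<^sup>2 \<le> Q"
      using cross[of \<sigma> w] unfolding Q_def by (simp add: abs_le_iff)
    moreover have "q * w\<^sup>2 \<le> 1 / 4 * w\<^sup>2" "q * \<sigma>\<^sup>2 \<le> k * \<gamma> / 2 * \<sigma>\<^sup>2"
      by (intro mult_right_mono; simp add: q_def)+
    ultimately have "q * (\<sigma>\<^sup>2 + w\<^sup>2) \<le> Q" by (simp add: algebra_simps)
    then have "\<bar>\<tau>\<bar> * (q * (\<sigma>\<^sup>2 + w\<^sup>2)) \<le> \<bar>\<tau>\<bar> * Q" by (intro mult_left_mono) auto
    moreover have "\<bar>sgn \<tau> * R \<sigma> w\<bar> \<le> \<bar>\<tau>\<bar> * q / 2 * (\<sigma>\<^sup>2 + w\<^sup>2)"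
      using R[of \<sigma> e w] that \<tau> C by (simp add: e_def abs_mult abs_sgn_eq)
    moreover have "c * twisted_energy \<gamma> s (k * \<tau>) \<sigma> w \<le> c * (M * (\<sigma>\<^sup>2 + w\<^sup>2))"
      using upper c by (intro mult_left_mono) auto
    moreover have "c * (M * (\<sigma>\<^sup>2 + w\<^sup>2)) = \<bar>\<tau>\<bar> * q / 2 * (\<sigma>\<^sup>2 + w\<^sup>2)"
      using M by (simp add: c_def)
    ultimately show ?thesis unfolding split by (simp add: abs_le_iff algebra_simps)
  qed
  have "twisted_energy \<gamma> s (k * \<tau>) \<sigma> w > 0" if "\<sigma> \<noteq> 0 \<or> w \<noteq> 0" for \<sigma> w
  proof -
    have "\<gamma> / (8 * s) * \<sigma>\<^sup>2 + w\<^sup>2 / 4 > 0"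
      using that \<gamma> s by (auto intro: add_pos_nonneg add_nonneg_pos)
    then show ?thesis using posdef[of \<sigma> w] by linarith
  qed
  then show ?thesis using that[OF c e] rate by blast
qed

section \<open>The invariant circle\<close>

text \<open>At the height \<open>z = \<alpha> - \<mu>\<close> the radial growth rate \<open>\<mu> - \<alpha> + z\<close> vanishes, so \<open>(x, y)\<close> rotates
rigidly with angular velocity \<open>\<beta>\<close>; the last assumption is \<open>z' = 0\<close> on the circle of squared radius
\<open>s\<close> at that height.\<close>

locale zero_hopf_circle =
  fixes \<alpha> \<beta> \<gamma> \<mu> s :: real
  assumes \<beta>: "\<beta> > 0" and \<gamma>: "\<gamma> > 0" and s: "s > 0"
    and equilibrium: "\<gamma> * (s + (\<alpha> - \<mu>)\<^sup>2) = \<mu> * (\<alpha> - \<mu>)"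
begin

definition orbit :: "real \<Rightarrow> real3" where
  "orbit t = (sqrt s * cos (\<beta> * t), sqrt s * sin (\<beta> * t), \<alpha> - \<mu>)"

text \<open>The trace of the linearised planar system at \<open>\<sigma> = w = 0\<close>; its determinant is \<open>2 * \<gamma> * s > 0\<close>, so the
sign of the trace decides stability.\<close>

definition planar_trace :: real where
  "planar_trace = \<mu> - 2 * \<gamma> * (\<alpha> - \<mu>)"

definition \<sigma> :: "real3 \<Rightarrow> real" where
  "\<sigma> p = (fst p)\<^sup>2 + (fst (snd p))\<^sup>2 - s"

definition w :: "real3 \<Rightarrow> real" where
  "w p = snd (snd p) - (\<alpha> - \<mu>)"

lemma range_orbit: "range orbit = {p. \<sigma> p = 0 \<and> w p = 0}"
proof (intro equalityI subsetI)
  fix p assume "p \<in> range orbit"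
  then show "p \<in> {p. \<sigma> p = 0 \<and> w p = 0}"
    using s by (auto simp: orbit_def \<sigma>_def w_def power_mult_distrib distrib_left[symmetric])
next
  fix p assume "p \<in> {p. \<sigma> p = 0 \<and> w p = 0}"
  moreover obtain x y z where p: "p = (x, y, z)" by (cases p)
  ultimately have xy: "x\<^sup>2 + y\<^sup>2 = s" and z: "z = \<alpha> - \<mu>" by (auto simp: \<sigma>_def w_def)
  have "(x / sqrt s)\<^sup>2 + (y / sqrt s)\<^sup>2 = (x\<^sup>2 + y\<^sup>2) / s"
    using s by (simp add: power_divide add_divide_distrib)
  then have "(x / sqrt s)\<^sup>2 + (y / sqrt s)\<^sup>2 = 1" using s xy by simp
  then obtain u where "x / sqrt s = cos u" "y / sqrt s = sin u"
    using sincos_total_2pi by blast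
  then have "p = orbit (u / \<beta>)"
    using s \<beta> z by (simp add: p orbit_def field_simps)
  then show "p \<in> range orbit" by blast
qed

lemma orbit_periodic_solution:
  "periodic_solution (zero_hopf_field \<alpha> \<beta> \<gamma> \<mu>) orbit"
  unfolding periodic_solution_def
proof (intro conjI)
  have "(orbit has_vector_derivative zero_hopf_field \<alpha> \<beta> \<gamma> \<mu> (orbit t)) (at t)" for t
  proof -
    have "(sqrt s * cos (\<beta> * t))\<^sup>2 + (sqrt s * sin (\<beta> * t))\<^sup>2 = s"
      using s by (simp add: power_mult_distrib distrib_left[symmetric])
    then have "zero_hopf_field \<alpha> \<beta> \<gamma> \<mu> (orbit t) =
        (- (sqrt s * sin (\<beta> * t) * \<beta>), sqrt s * cos (\<beta> * t) * \<beta>, 0)"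
      using equilibrium by (auto simp: zero_hopf_field_def orbit_def) (simp_all add: algebra_simps)
    moreover have "(orbit has_vector_derivative
        (- (sqrt s * sin (\<beta> * t) * \<beta>), sqrt s * cos (\<beta> * t) * \<beta>, 0)) (at t)"
      unfolding orbit_def[abs_def]
      by (intro has_vector_derivative_Pair)
        (auto simp: has_real_derivative_iff_has_vector_derivative[symmetric] intro!: derivative_eq_intros)
    ultimately show ?thesis by simp
  qed
  then show "is_solution_on (zero_hopf_field \<alpha> \<beta> \<gamma> \<mu>) orbit UNIV"
    by (simp add: is_solution_on_def)
  have "orbit (t + 2 * pi / \<beta>) = orbit t" for t
    using \<beta> by (simp add: orbit_def distrib_left)
  then show "\<exists>T>0. \<forall>t. orbit (t + T) = orbit t"
    using \<beta> by (intro exI[of _ "2 * pi / \<beta>"]) simp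
  have "orbit 0 \<noteq> orbit (pi / \<beta>)" using \<beta> s by (simp add: orbit_def)
  then show "\<not> orbit constant_on UNIV" unfolding constant_on_def by (metis UNIV_I)
qed

lemma compact_range_orbit: "compact (range orbit)"
proof -
  have "closed (range orbit)"
    unfolding range_orbit \<sigma>_def w_def
    by (intro closed_Collect_conj closed_Collect_eq continuous_intros)
  moreover have "norm (orbit t) \<le> sqrt s + (sqrt s + \<bar>\<alpha> - \<mu>\<bar>)" for t
  proof -
    have "\<bar>sqrt s * cos (\<beta> * t)\<bar> \<le> sqrt s" "\<bar>sqrt s * sin (\<beta> * t)\<bar> \<le> sqrt s"
      using s by (auto simp: abs_mult mult_left_le)
    then show ?thesis
      using norm_Pair_le[of "sqrt s * cos (\<beta> * t)" "(sqrt s * sin (\<beta> * t), \<alpha> - \<mu>)"]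
        norm_Pair_le[of "sqrt s * sin (\<beta> * t)" "\<alpha> - \<mu>"]
      by (simp add: orbit_def)
  qed
  then have "bounded (range orbit)" unfolding bounded_iff by blast
  ultimately show ?thesis by (simp add: compact_eq_bounded_closed)
qed

definition W :: "real \<Rightarrow> real3 \<Rightarrow> real" where
  "W \<kappa> p = twisted_energy \<gamma> s \<kappa> (\<sigma> p) (w p)"

definition W' :: "real \<Rightarrow> real3 \<Rightarrow> real3 \<Rightarrow> real" where
  "W' \<kappa> p h = (\<gamma> / (2 * s) * \<sigma> p - \<kappa> * w p) * (2 * fst p * fst h + 2 * fst (snd p) * fst (snd h))
     + (w p - \<kappa> * \<sigma> p) * snd (snd h)"

lemma has_derivative_W: "(W \<kappa> has_derivative W' \<kappa> p) (at p)"
  unfolding W_def[abs_def] W'_def[abs_def] twisted_energy_def \<sigma>_def w_def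
  using s by (auto intro!: derivative_eq_intros ext simp: field_simps power2_eq_square)

lemma W'_along_field:
  "W' \<kappa> p (zero_hopf_field \<alpha> \<beta> \<gamma> \<mu> p) = twisted_energy_rate \<gamma> s planar_trace \<kappa> (\<sigma> p) (w p)"
proof -
  obtain x y z where p: "p = (x, y, z)" by (cases p)
  let ?F = "zero_hopf_field \<alpha> \<beta> \<gamma> \<mu> p"
  have 1: "2 * fst p * fst ?F + 2 * fst (snd p) * fst (snd ?F) = 2 * (\<sigma> p + s) * w p"
    by (simp add: p zero_hopf_field_def \<sigma>_def w_def algebra_simps power2_eq_square)
  have "snd (snd ?F) - (planar_trace * w p - \<gamma> * \<sigma> p - \<gamma> * (w p)\<^sup>2)
      = \<mu> * (\<alpha> - \<mu>) - \<gamma> * (s + (\<alpha> - \<mu>)\<^sup>2)"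
    by (simp add: p zero_hopf_field_def \<sigma>_def w_def planar_trace_def algebra_simps power2_eq_square)
  then have 2: "snd (snd ?F) = planar_trace * w p - \<gamma> * \<sigma> p - \<gamma> * (w p)\<^sup>2"
    using equilibrium by simp
  show ?thesis unfolding W'_def twisted_energy_rate_def 1 2 ..
qed

lemma lyapunov_candidate_near_orbit:
  assumes "planar_trace \<noteq> 0"
  obtains \<kappa> \<rho> c where
    "lyapunov_candidate (range orbit) (W \<kappa>) (W' \<kappa>) \<rho> c"
    "\<And>p. infdist p (range orbit) \<le> \<rho> \<Longrightarrow>
      c * W \<kappa> p \<le> sgn planar_trace * W' \<kappa> p (zero_hopf_field \<alpha> \<beta> \<gamma> \<mu> p)"
proof (rule twisted_energy_estimates[OF \<gamma> s assms])
  fix c e \<kappa> :: real assume "c > 0" "e > 0"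
    and pos: "\<And>\<sigma> w. \<sigma> \<noteq> 0 \<or> w \<noteq> 0 \<Longrightarrow> twisted_energy \<gamma> s \<kappa> \<sigma> w > 0"
    and rate: "\<And>\<sigma> w. \<bar>\<sigma>\<bar> < e \<Longrightarrow> \<bar>w\<bar> < e \<Longrightarrow>
       c * twisted_energy \<gamma> s \<kappa> \<sigma> w \<le> sgn planar_trace * twisted_energy_rate \<gamma> s planar_trace \<kappa> \<sigma> w"
  have ne: "range orbit \<noteq> {}" by simp
  obtain \<rho>\<^sub>1 where \<rho>\<^sub>1: "\<rho>\<^sub>1 > 0" "\<And>p. infdist p (range orbit) \<le> \<rho>\<^sub>1 \<Longrightarrow> \<bar>\<sigma> p\<bar> < e"
  proof (rule small_near_zero_set[OF ne compact_range_orbit])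
    show "continuous_on UNIV \<sigma>" unfolding \<sigma>_def[abs_def] by (intro continuous_intros)
    show "\<sigma> p = 0" if "p \<in> range orbit" for p using that range_orbit by blast
  qed (use \<open>e > 0\<close> in auto)
  obtain \<rho>\<^sub>2 where \<rho>\<^sub>2: "\<rho>\<^sub>2 > 0" "\<And>p. infdist p (range orbit) \<le> \<rho>\<^sub>2 \<Longrightarrow> \<bar>w p\<bar> < e"
  proof (rule small_near_zero_set[OF ne compact_range_orbit])
    show "continuous_on UNIV w" unfolding w_def[abs_def] by (intro continuous_intros)
    show "w p = 0" if "p \<in> range orbit" for p using that range_orbit by blast
  qed (use \<open>e > 0\<close> in auto)
  show ?thesis
  proof (rule that[of \<kappa> "min \<rho>\<^sub>1 \<rho>\<^sub>2" c])
    show "lyapunov_candidate (range orbit) (W \<kappa>) (W' \<kappa>) (min \<rho>\<^sub>1 \<rho>\<^sub>2) c"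
    proof
      show "W \<kappa> p = 0" if "p \<in> range orbit" for p
        using that unfolding range_orbit by (simp add: W_def twisted_energy_def)
      show "W \<kappa> p > 0" if "0 < infdist p (range orbit)" for p
      proof -
        have "p \<notin> range orbit" using that by (metis infdist_zero less_irrefl)
        then have "\<sigma> p \<noteq> 0 \<or> w p \<noteq> 0" unfolding range_orbit by simp
        then show ?thesis using pos by (simp add: W_def)
      qed
    qed (use \<rho>\<^sub>1 \<rho>\<^sub>2 \<open>c > 0\<close> compact_range_orbit has_derivative_W in auto)
    show "c * W \<kappa> p \<le> sgn planar_trace * W' \<kappa> p (zero_hopf_field \<alpha> \<beta> \<gamma> \<mu> p)"
      if "infdist p (range orbit) \<le> min \<rho>\<^sub>1 \<rho>\<^sub>2" for p
      using rate[of "\<sigma> p" "w p"] \<rho>\<^sub>1(2)[of p] \<rho>\<^sub>2(2)[of p] that by (simp add: W'_along_field W_def)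
  qed
qed

lemma stable_if_trace_negative:
  assumes "planar_trace < 0"
  shows "orbitally_asymptotically_stable (zero_hopf_field \<alpha> \<beta> \<gamma> \<mu>) (range orbit)"
proof (rule lyapunov_candidate_near_orbit)
  show "planar_trace \<noteq> 0" using assms by simp
next
  fix \<kappa> \<rho> c :: real assume lyap: "lyapunov_candidate (range orbit) (W \<kappa>) (W' \<kappa>) \<rho> c"
    and rate: "\<And>p. infdist p (range orbit) \<le> \<rho> \<Longrightarrow>
      c * W \<kappa> p \<le> sgn planar_trace * W' \<kappa> p (zero_hopf_field \<alpha> \<beta> \<gamma> \<mu> p)"
  show ?thesis
  proof (rule lyapunov_candidate.exponential_decrease_imp_orbitally_asymptotically_stable[OF lyap])
    show "W' \<kappa> p (zero_hopf_field \<alpha> \<beta> \<gamma> \<mu> p) \<le> - c * W \<kappa> p" if "infdist p (range orbit) \<le> \<rho>" for p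
      using rate[OF that] assms by simp
    show "\<exists>L. L-lipschitz_on (cbox a b) (zero_hopf_field \<alpha> \<beta> \<gamma> \<mu>)" for a b
      by (intro lipschitz_zero_hopf_field compact_cbox)
  qed
qed

lemma unstable_if_trace_positive:
  assumes "planar_trace > 0"
  shows "orbitally_unstable (zero_hopf_field \<alpha> \<beta> \<gamma> \<mu>) (range orbit)"
proof (rule lyapunov_candidate_near_orbit)
  show "planar_trace \<noteq> 0" using assms by simp
next
  fix \<kappa> \<rho> c :: real assume lyap: "lyapunov_candidate (range orbit) (W \<kappa>) (W' \<kappa>) \<rho> c"
    and rate: "\<And>p. infdist p (range orbit) \<le> \<rho> \<Longrightarrow>
      c * W \<kappa> p \<le> sgn planar_trace * W' \<kappa> p (zero_hopf_field \<alpha> \<beta> \<gamma> \<mu> p)"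
  show ?thesis
  proof (rule lyapunov_candidate.exponential_increase_imp_orbitally_unstable[OF lyap])
    show "W' \<kappa> p (zero_hopf_field \<alpha> \<beta> \<gamma> \<mu> p) \<ge> c * W \<kappa> p" if "infdist p (range orbit) \<le> \<rho>" for p
      using rate[OF that] assms by simp
    fix \<delta> :: real assume "\<delta> > 0"
    let ?p = "(sqrt s, 0, \<alpha> - \<mu> + \<delta> / 2) :: real3"
    have "?p \<notin> range orbit" using \<open>\<delta> > 0\<close> by (simp add: range_orbit w_def)
    then have "infdist ?p (range orbit) > 0"
      by (intro infdist_pos_not_in_closed compact_imp_closed compact_range_orbit) auto
    moreover have "infdist ?p (range orbit) \<le> dist ?p (orbit 0)" by (intro infdist_le) simp
    moreover have "dist ?p (orbit 0) < \<delta>"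
      using \<open>\<delta> > 0\<close> by (simp add: orbit_def dist_Pair_Pair dist_real_def)
    ultimately show "\<exists>p. 0 < infdist p (range orbit) \<and> infdist p (range orbit) < \<delta>"
      by (intro exI[of _ ?p]) linarith
  qed
qed

end

section \<open>Small parameters\<close>

lemma tendsto_divide_of_expansion:
  fixes f :: "real \<Rightarrow> real"
  assumes "(\<lambda>\<epsilon>. f \<epsilon> - (a * \<epsilon> + b * \<epsilon>\<^sup>2)) \<in> O[at 0](\<lambda>\<epsilon>. \<epsilon> ^ 3)"
  shows "((\<lambda>\<epsilon>. f \<epsilon> / \<epsilon>) \<longlongrightarrow> a) (at_right 0)"
proof -
  have "(\<lambda>\<epsilon>. f \<epsilon> - (a * \<epsilon> + b * \<epsilon>\<^sup>2)) \<in> o[at 0](\<lambda>\<epsilon>. \<epsilon>)"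
    using assms by (rule landau_o.big_small_trans) real_asymp
  then have "((\<lambda>\<epsilon>. (f \<epsilon> - (a * \<epsilon> + b * \<epsilon>\<^sup>2)) / \<epsilon>) \<longlongrightarrow> 0) (at 0)"
    by (rule smalloD_tendsto)
  then have "((\<lambda>\<epsilon>. (f \<epsilon> - (a * \<epsilon> + b * \<epsilon>\<^sup>2)) / \<epsilon>) \<longlongrightarrow> 0) (at_right 0)"
    by (rule tendsto_within_subset) simp
  moreover have "((\<lambda>\<epsilon>. a + b * \<epsilon>) \<longlongrightarrow> a) (at_right 0)" by real_asymp
  ultimately have "((\<lambda>\<epsilon>. (f \<epsilon> - (a * \<epsilon> + b * \<epsilon>\<^sup>2)) / \<epsilon> + (a + b * \<epsilon>)) \<longlongrightarrow> 0 + a) (at_right 0)"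
    by (rule tendsto_add)
  then have "((\<lambda>\<epsilon>. (f \<epsilon> - (a * \<epsilon> + b * \<epsilon>\<^sup>2)) / \<epsilon> + (a + b * \<epsilon>)) \<longlongrightarrow> a) (at_right 0)" by simp
  moreover have "\<forall>\<^sub>F \<epsilon> in at_right 0. (f \<epsilon> - (a * \<epsilon> + b * \<epsilon>\<^sup>2)) / \<epsilon> + (a + b * \<epsilon>) = f \<epsilon> / \<epsilon>"
    using eventually_at_right_less[of "0::real"]
    by eventually_elim (simp add: field_simps power2_eq_square)
  ultimately show ?thesis by (rule Lim_transform_eventually)
qed

lemma tendsto_of_expansion:
  fixes f :: "real \<Rightarrow> real"
  assumes "(\<lambda>\<epsilon>. f \<epsilon> - (a\<^sub>0 + a * \<epsilon> + b * \<epsilon>\<^sup>2)) \<in> O[at 0](\<lambda>\<epsilon>. \<epsilon> ^ 3)"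
  shows "(f \<longlongrightarrow> a\<^sub>0) (at_right 0)"
proof -
  have "(\<lambda>\<epsilon>. (f \<epsilon> - a\<^sub>0) - (a * \<epsilon> + b * \<epsilon>\<^sup>2)) \<in> O[at 0](\<lambda>\<epsilon>. \<epsilon> ^ 3)"
    using assms by (simp add: algebra_simps)
  note tendsto_divide_of_expansion[OF this]
  moreover have "((\<lambda>\<epsilon>. \<epsilon>) \<longlongrightarrow> 0) (at_right (0::real))" by (rule tendsto_ident_at)
  ultimately have "((\<lambda>\<epsilon>. (f \<epsilon> - a\<^sub>0) / \<epsilon> * \<epsilon> + a\<^sub>0) \<longlongrightarrow> a * 0 + a\<^sub>0) (at_right 0)"
    by (intro tendsto_intros)
  then have "((\<lambda>\<epsilon>. (f \<epsilon> - a\<^sub>0) / \<epsilon> * \<epsilon> + a\<^sub>0) \<longlongrightarrow> a\<^sub>0) (at_right 0)" by simp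
  moreover have "\<forall>\<^sub>F \<epsilon> in at_right 0. (f \<epsilon> - a\<^sub>0) / \<epsilon> * \<epsilon> + a\<^sub>0 = f \<epsilon>"
    using eventually_at_right_less[of "0::real"] by eventually_elim simp
  ultimately show ?thesis by (rule Lim_transform_eventually)
qed

text \<open>As \<open>\<alpha>\<close> and \<open>\<mu>\<close> are of order \<open>\<epsilon>\<close>, the height \<open>\<zeta>\<close> and the trace are of order \<open>\<epsilon>\<close> and the squared
radius \<open>s\<close> is of order \<open>\<epsilon>\<^sup>2\<close>. The sign conditions are those on the limits of \<open>s / \<epsilon>\<^sup>2\<close> and of the trace
divided by \<open>\<epsilon>\<close>.\<close>

theorem theorem1:
  fixes \<alpha> \<beta> \<gamma> \<mu> :: "real \<Rightarrow> real"
    and \<omega> \<alpha>\<^sub>1 \<alpha>\<^sub>2 \<beta>\<^sub>1 \<beta>\<^sub>2 \<gamma>\<^sub>0 \<gamma>\<^sub>1 \<gamma>\<^sub>2 \<mu>\<^sub>1 \<mu>\<^sub>2 :: real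
  assumes "\<omega> > 0"
    and "smooth_near_0 \<alpha>" and "smooth_near_0 \<beta>" and "smooth_near_0 \<gamma>" and "smooth_near_0 \<mu>"
    and "(\<lambda>\<epsilon>. \<alpha> \<epsilon> - (\<alpha>\<^sub>1 * \<epsilon> + \<alpha>\<^sub>2 * \<epsilon>\<^sup>2)) \<in> O[at 0](\<lambda>\<epsilon>. \<epsilon> ^ 3)"
    and "(\<lambda>\<epsilon>. \<beta> \<epsilon> - (\<omega> + \<beta>\<^sub>1 * \<epsilon> + \<beta>\<^sub>2 * \<epsilon>\<^sup>2)) \<in> O[at 0](\<lambda>\<epsilon>. \<epsilon> ^ 3)"
    and "(\<lambda>\<epsilon>. \<gamma> \<epsilon> - (\<gamma>\<^sub>0 + \<gamma>\<^sub>1 * \<epsilon> + \<gamma>\<^sub>2 * \<epsilon>\<^sup>2)) \<in> O[at 0](\<lambda>\<epsilon>. \<epsilon> ^ 3)"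
    and "(\<lambda>\<epsilon>. \<mu> \<epsilon> - (\<mu>\<^sub>1 * \<epsilon> + \<mu>\<^sub>2 * \<epsilon>\<^sup>2)) \<in> O[at 0](\<lambda>\<epsilon>. \<epsilon> ^ 3)"
    and "\<alpha>\<^sub>1 \<noteq> 0" and "\<gamma>\<^sub>0 > 0"
    and "(\<mu>\<^sub>1 - \<alpha>\<^sub>1) * (\<alpha>\<^sub>1 * \<gamma>\<^sub>0 - (\<gamma>\<^sub>0 + 1) * \<mu>\<^sub>1) > 0"
    and "4 * \<alpha>\<^sub>1\<^sup>2 * \<gamma>\<^sub>0 * (\<gamma>\<^sub>0 + 2) - 4 * \<alpha>\<^sub>1 * (\<gamma>\<^sub>0 + 2) * (2 * \<gamma>\<^sub>0 + 1) * \<mu>\<^sub>1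
           + (2 * \<gamma>\<^sub>0 + 3)\<^sup>2 * \<mu>\<^sub>1\<^sup>2 < 0"
  shows "\<exists>\<phi> :: real \<Rightarrow> real \<Rightarrow> real3.
     (\<forall>\<^sub>F \<epsilon> in at_right 0.
        periodic_solution (zero_hopf_field (\<alpha> \<epsilon>) (\<beta> \<epsilon>) (\<gamma> \<epsilon>) (\<mu> \<epsilon>)) (\<lambda>t. \<phi> t \<epsilon>)) \<and>
     uniform_limit UNIV (\<lambda>\<epsilon> t. \<phi> t \<epsilon>) (\<lambda>t. 0) (at_right 0) \<and>
     (2 * \<gamma>\<^sub>0 * (\<mu>\<^sub>1 - \<alpha>\<^sub>1) + \<mu>\<^sub>1 < 0 \<longrightarrow>
        (\<forall>\<^sub>F \<epsilon> in at_right 0. orbitally_asymptotically_stable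
           (zero_hopf_field (\<alpha> \<epsilon>) (\<beta> \<epsilon>) (\<gamma> \<epsilon>) (\<mu> \<epsilon>)) (range (\<lambda>t. \<phi> t \<epsilon>)))) \<and>
     (2 * \<gamma>\<^sub>0 * (\<mu>\<^sub>1 - \<alpha>\<^sub>1) + \<mu>\<^sub>1 > 0 \<longrightarrow>
        (\<forall>\<^sub>F \<epsilon> in at_right 0. orbitally_unstable
           (zero_hopf_field (\<alpha> \<epsilon>) (\<beta> \<epsilon>) (\<gamma> \<epsilon>) (\<mu> \<epsilon>)) (range (\<lambda>t. \<phi> t \<epsilon>))))"
proof -
  note pos_radius = assms(12)
  have lim_\<alpha>: "((\<lambda>\<epsilon>. \<alpha> \<epsilon> / \<epsilon>) \<longlongrightarrow> \<alpha>\<^sub>1) (at_right 0)"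
    and lim_\<mu>: "((\<lambda>\<epsilon>. \<mu> \<epsilon> / \<epsilon>) \<longlongrightarrow> \<mu>\<^sub>1) (at_right 0)"
    and lim_\<beta>: "(\<beta> \<longlongrightarrow> \<omega>) (at_right 0)" and lim_\<gamma>: "(\<gamma> \<longlongrightarrow> \<gamma>\<^sub>0) (at_right 0)"
    by (rule tendsto_divide_of_expansion tendsto_of_expansion; fact)+
  have lim_id: "((\<lambda>\<epsilon>. \<epsilon>) \<longlongrightarrow> 0) (at_right (0::real))" by (rule tendsto_ident_at)
  have ev_pos: "\<forall>\<^sub>F \<epsilon> in at_right 0. (0::real) < \<epsilon>" by (rule eventually_at_right_less)

  define \<zeta> where "\<zeta> \<epsilon> = \<alpha> \<epsilon> - \<mu> \<epsilon>" for \<epsilon>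
  \<comment> \<open>\<open>z' = 0\<close> on the circle, solved for the squared radius\<close>
  define s where "s \<epsilon> = \<zeta> \<epsilon> * (\<mu> \<epsilon> - \<gamma> \<epsilon> * \<zeta> \<epsilon>) / \<gamma> \<epsilon>" for \<epsilon>
  define \<phi> where "\<phi> t \<epsilon> = (sqrt (s \<epsilon>) * cos (\<beta> \<epsilon> * t), sqrt (s \<epsilon>) * sin (\<beta> \<epsilon> * t), \<zeta> \<epsilon>)" for t \<epsilon>

  have lim_\<zeta>1: "((\<lambda>\<epsilon>. \<zeta> \<epsilon> / \<epsilon>) \<longlongrightarrow> \<alpha>\<^sub>1 - \<mu>\<^sub>1) (at_right 0)"
    unfolding \<zeta>_def diff_divide_distrib by (intro tendsto_diff lim_\<alpha> lim_\<mu>)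
  let ?s\<^sub>0 = "(\<alpha>\<^sub>1 - \<mu>\<^sub>1) * (\<mu>\<^sub>1 - \<gamma>\<^sub>0 * (\<alpha>\<^sub>1 - \<mu>\<^sub>1)) / \<gamma>\<^sub>0"
  have "((\<lambda>\<epsilon>. (\<zeta> \<epsilon> / \<epsilon>) * (\<mu> \<epsilon> / \<epsilon> - \<gamma> \<epsilon> * (\<zeta> \<epsilon> / \<epsilon>)) / \<gamma> \<epsilon>) \<longlongrightarrow> ?s\<^sub>0) (at_right 0)"
    using \<open>\<gamma>\<^sub>0 > 0\<close> by (intro tendsto_intros lim_\<zeta>1 lim_\<mu> lim_\<gamma>) simp
  moreover have "\<forall>\<^sub>F \<epsilon> in at_right 0.
      (\<zeta> \<epsilon> / \<epsilon>) * (\<mu> \<epsilon> / \<epsilon> - \<gamma> \<epsilon> * (\<zeta> \<epsilon> / \<epsilon>)) / \<gamma> \<epsilon> = s \<epsilon> / \<epsilon>\<^sup>2"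
    using ev_pos by eventually_elim (simp add: s_def power2_eq_square diff_divide_distrib[symmetric])
  ultimately have lim_s2: "((\<lambda>\<epsilon>. s \<epsilon> / \<epsilon>\<^sup>2) \<longlongrightarrow> ?s\<^sub>0) (at_right 0)"
    by (rule Lim_transform_eventually)
  have "?s\<^sub>0 = (\<mu>\<^sub>1 - \<alpha>\<^sub>1) * (\<alpha>\<^sub>1 * \<gamma>\<^sub>0 - (\<gamma>\<^sub>0 + 1) * \<mu>\<^sub>1) / \<gamma>\<^sub>0"
    using \<open>\<gamma>\<^sub>0 > 0\<close> by (simp add: field_simps)
  then have "?s\<^sub>0 > 0" using pos_radius \<open>\<gamma>\<^sub>0 > 0\<close> by simp
  then have "\<forall>\<^sub>F \<epsilon> in at_right 0. 0 < s \<epsilon> / \<epsilon>\<^sup>2" by (rule order_tendstoD(1)[OF lim_s2])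
  then have ev_s: "\<forall>\<^sub>F \<epsilon> in at_right 0. 0 < s \<epsilon>"
    using ev_pos by eventually_elim (simp add: zero_less_divide_iff)
  have ev_\<beta>: "\<forall>\<^sub>F \<epsilon> in at_right 0. 0 < \<beta> \<epsilon>" and ev_\<gamma>: "\<forall>\<^sub>F \<epsilon> in at_right 0. 0 < \<gamma> \<epsilon>"
    using order_tendstoD(1)[OF lim_\<beta>] order_tendstoD(1)[OF lim_\<gamma>] \<open>\<omega> > 0\<close> \<open>\<gamma>\<^sub>0 > 0\<close> by auto

  have circle: "\<forall>\<^sub>F \<epsilon> in at_right 0. zero_hopf_circle (\<alpha> \<epsilon>) (\<beta> \<epsilon>) (\<gamma> \<epsilon>) (\<mu> \<epsilon>) (s \<epsilon>)"
    using ev_s ev_\<beta> ev_\<gamma>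
  proof eventually_elim
    case (elim \<epsilon>)
    then show ?case
      by unfold_locales (auto simp: s_def \<zeta>_def field_simps power2_eq_square)
  qed
  have orbit: "(\<lambda>t. \<phi> t \<epsilon>) = zero_hopf_circle.orbit (\<alpha> \<epsilon>) (\<beta> \<epsilon>) (\<mu> \<epsilon>) (s \<epsilon>)"
    if "zero_hopf_circle (\<alpha> \<epsilon>) (\<beta> \<epsilon>) (\<gamma> \<epsilon>) (\<mu> \<epsilon>) (s \<epsilon>)" for \<epsilon>
    using zero_hopf_circle.orbit_def[OF that] by (auto simp: \<phi>_def \<zeta>_def)

  have periodic: "\<forall>\<^sub>F \<epsilon> in at_right 0.
      periodic_solution (zero_hopf_field (\<alpha> \<epsilon>) (\<beta> \<epsilon>) (\<gamma> \<epsilon>) (\<mu> \<epsilon>)) (\<lambda>t. \<phi> t \<epsilon>)"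
    using circle by eventually_elim (simp add: orbit zero_hopf_circle.orbit_periodic_solution)

  have small: "uniform_limit UNIV (\<lambda>\<epsilon> t. \<phi> t \<epsilon>) (\<lambda>t. 0) (at_right 0)"
    unfolding uniform_limit_iff
  proof (intro allI impI)
    fix e :: real assume "e > 0"
    have "((\<lambda>\<epsilon>. s \<epsilon> / \<epsilon>\<^sup>2 * \<epsilon>\<^sup>2) \<longlongrightarrow> ?s\<^sub>0 * 0\<^sup>2) (at_right 0)"
      by (intro tendsto_mult tendsto_power lim_s2 lim_id)
    moreover have "\<forall>\<^sub>F \<epsilon> in at_right 0. s \<epsilon> / \<epsilon>\<^sup>2 * \<epsilon>\<^sup>2 = s \<epsilon>"
      using ev_pos by eventually_elim simp
    ultimately have lim_s: "(s \<longlongrightarrow> ?s\<^sub>0 * 0\<^sup>2) (at_right 0)" by (rule Lim_transform_eventually)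
    have "((\<lambda>\<epsilon>. \<zeta> \<epsilon> / \<epsilon> * \<epsilon>) \<longlongrightarrow> (\<alpha>\<^sub>1 - \<mu>\<^sub>1) * 0) (at_right 0)"
      by (intro tendsto_mult lim_\<zeta>1 lim_id)
    moreover have "\<forall>\<^sub>F \<epsilon> in at_right 0. \<zeta> \<epsilon> / \<epsilon> * \<epsilon> = \<zeta> \<epsilon>"
      using ev_pos by eventually_elim simp
    ultimately have lim_\<zeta>: "(\<zeta> \<longlongrightarrow> (\<alpha>\<^sub>1 - \<mu>\<^sub>1) * 0) (at_right 0)" by (rule Lim_transform_eventually)
    have "((\<lambda>\<epsilon>. 2 * \<bar>sqrt (s \<epsilon>)\<bar> + \<bar>\<zeta> \<epsilon>\<bar>) \<longlongrightarrow> 2 * \<bar>sqrt (?s\<^sub>0 * 0\<^sup>2)\<bar> + \<bar>(\<alpha>\<^sub>1 - \<mu>\<^sub>1) * 0\<bar>) (at_right 0)"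
      by (intro tendsto_intros lim_s lim_\<zeta>)
    then have "\<forall>\<^sub>F \<epsilon> in at_right 0. 2 * \<bar>sqrt (s \<epsilon>)\<bar> + \<bar>\<zeta> \<epsilon>\<bar> < e"
      using \<open>e > 0\<close> by (intro order_tendstoD(2)) auto
    then show "\<forall>\<^sub>F \<epsilon> in at_right 0. \<forall>t\<in>UNIV. dist (\<phi> t \<epsilon>) 0 < e"
    proof eventually_elim
      case (elim \<epsilon>)
      show ?case
      proof
        fix t
        have "\<bar>sqrt (s \<epsilon>) * cos (\<beta> \<epsilon> * t)\<bar> \<le> \<bar>sqrt (s \<epsilon>)\<bar>" "\<bar>sqrt (s \<epsilon>) * sin (\<beta> \<epsilon> * t)\<bar> \<le> \<bar>sqrt (s \<epsilon>)\<bar>"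
          by (auto simp: abs_mult mult_left_le)
        then have "norm (\<phi> t \<epsilon>) \<le> 2 * \<bar>sqrt (s \<epsilon>)\<bar> + \<bar>\<zeta> \<epsilon>\<bar>"
          using norm_Pair_le[of "sqrt (s \<epsilon>) * cos (\<beta> \<epsilon> * t)" "(sqrt (s \<epsilon>) * sin (\<beta> \<epsilon> * t), \<zeta> \<epsilon>)"]
            norm_Pair_le[of "sqrt (s \<epsilon>) * sin (\<beta> \<epsilon> * t)" "\<zeta> \<epsilon>"]
          by (simp add: \<phi>_def)
        then show "dist (\<phi> t \<epsilon>) 0 < e" using elim by simp
      qed
    qed
  qed

  let ?\<tau> = "\<lambda>\<epsilon>. \<mu> \<epsilon> - 2 * \<gamma> \<epsilon> * (\<alpha> \<epsilon> - \<mu> \<epsilon>)"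
  have "((\<lambda>\<epsilon>. \<mu> \<epsilon> / \<epsilon> - 2 * \<gamma> \<epsilon> * (\<zeta> \<epsilon> / \<epsilon>)) \<longlongrightarrow> \<mu>\<^sub>1 - 2 * \<gamma>\<^sub>0 * (\<alpha>\<^sub>1 - \<mu>\<^sub>1)) (at_right 0)"
    by (intro tendsto_intros lim_\<mu> lim_\<gamma> lim_\<zeta>1)
  moreover have "(\<lambda>\<epsilon>. \<mu> \<epsilon> / \<epsilon> - 2 * \<gamma> \<epsilon> * (\<zeta> \<epsilon> / \<epsilon>)) = (\<lambda>\<epsilon>. ?\<tau> \<epsilon> / \<epsilon>)"
    by (simp add: \<zeta>_def diff_divide_distrib[symmetric])
  moreover have "\<mu>\<^sub>1 - 2 * \<gamma>\<^sub>0 * (\<alpha>\<^sub>1 - \<mu>\<^sub>1) = 2 * \<gamma>\<^sub>0 * (\<mu>\<^sub>1 - \<alpha>\<^sub>1) + \<mu>\<^sub>1"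
    by (simp add: algebra_simps)
  ultimately have lim_\<tau>: "((\<lambda>\<epsilon>. ?\<tau> \<epsilon> / \<epsilon>) \<longlongrightarrow> 2 * \<gamma>\<^sub>0 * (\<mu>\<^sub>1 - \<alpha>\<^sub>1) + \<mu>\<^sub>1) (at_right 0)"
    by simp

  have stable: "\<forall>\<^sub>F \<epsilon> in at_right 0. orbitally_asymptotically_stable
      (zero_hopf_field (\<alpha> \<epsilon>) (\<beta> \<epsilon>) (\<gamma> \<epsilon>) (\<mu> \<epsilon>)) (range (\<lambda>t. \<phi> t \<epsilon>))"
    if "2 * \<gamma>\<^sub>0 * (\<mu>\<^sub>1 - \<alpha>\<^sub>1) + \<mu>\<^sub>1 < 0"
    using circle ev_pos order_tendstoD(2)[OF lim_\<tau> that]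
  proof eventually_elim
    case (elim \<epsilon>)
    then have "?\<tau> \<epsilon> < 0" by (simp add: divide_less_0_iff)
    then show ?case
      unfolding orbit[OF elim(1)]
      by (intro zero_hopf_circle.stable_if_trace_negative[OF elim(1)])
        (simp add: zero_hopf_circle.planar_trace_def[OF elim(1)])
  qed
  have unstable: "\<forall>\<^sub>F \<epsilon> in at_right 0. orbitally_unstable
      (zero_hopf_field (\<alpha> \<epsilon>) (\<beta> \<epsilon>) (\<gamma> \<epsilon>) (\<mu> \<epsilon>)) (range (\<lambda>t. \<phi> t \<epsilon>))"
    if "2 * \<gamma>\<^sub>0 * (\<mu>\<^sub>1 - \<alpha>\<^sub>1) + \<mu>\<^sub>1 > 0"
    using circle ev_pos order_tendstoD(1)[OF lim_\<tau> that]
  proof eventually_elim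
    case (elim \<epsilon>)
    then have "?\<tau> \<epsilon> > 0" by (simp add: zero_less_divide_iff)
    then show ?case
      unfolding orbit[OF elim(1)]
      by (intro zero_hopf_circle.unstable_if_trace_positive[OF elim(1)])
        (simp add: zero_hopf_circle.planar_trace_def[OF elim(1)])
  qed
  show ?thesis using periodic small stable unstable by blast
qed

end
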